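(* General deduction is sound and complete with respect to the class of Venn models: for every $\Gamma\cup\{\sigma\}\subseteq BN(C)$, $\Gamma\vdash^{g}\sigma$ if and only if $\Gamma\vDash_{V}\sigma$.
   Context: Fix a set $C$ of constants with at least three elements. $BN(C)$ is the set of all strings (basic sentences) $Yab$ with $Y\in\{A,E,I,O\}$, $a,b\in C$ ($a=b$ allowed). Contradictories: $\widehat{Aab}=Oab$, $\widehat{Oab}=Aab$, $\widehat{Eab}=Iab$, $\widehat{Iab}=Eab$. The $d$-rules (for all $a,b,c\in C$): (A-Id) infer $Aaa$ from no premises; (Apc) from $Aab$ infer $Iba$; (Ec) from $Eab$ infer $Eba$; (Barbara) from $Aab,Abc$ infer $Aac$; (Celarent) from $Aab,Ebc$ infer $Eac$. $\Gamma\vdash^{d}\sigma$ means that there is a finite nonempty sequence of basic sentences ending in $\sigma$, each of whose terms is in $\Gamma$ or is the conclusion of a $d$-rule instance whose premises are earlier terms. $\Gamma$ is inconsistent if $\Gamma\vdash^{d}\sigma$ and $\Gamma\vdash^{d}\widehat\sigma$ for some $\sigma\in BN(C)$. General deduction: $\Gamma\vdash^{g}\sigma$ means that $\Gamma\cup\{\widehat\sigma\}$ is inconsistent. A Venn model is a pair $\langle B,\mu\rangle$ where $B$ is a nonempty collection of nonempty sets and $\mu:C\to B$. In it: $Aab$ is true iff $\mu(a)\subseteq\mu(b)$; $Iab$ is true iff $\mu(a)\cap\mu(b)\neq\emptyset$; $Eab$ is true iff $Iab$ is not; $Oab$ is true iff $Aab$ is not. $\Gamma\vDash_{V}\sigma$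 means that $\sigma$ is true in every Venn model in which all elements of $\Gamma$ are true. *)

theory Defs
  imports Main
begin

datatype 'c sentence =
    SenA 'c 'c
  | SenE 'c 'c
  | SenI 'c 'c
  | SenO 'c 'c

definition BN :: "'c set \<Rightarrow> 'c sentence set" where
  "BN C = {\<sigma>. \<exists>a\<in>C. \<exists>b\<in>C. \<sigma> = SenA a b \<or> \<sigma> = SenE a b \<or> \<sigma> = SenI a b \<or> \<sigma> = SenO a b}"

primrec contradictory :: "'c sentence \<Rightarrow> 'c sentence" where
  "contradictory (SenA a b) = SenO a b"
| "contradictory (SenO a b) = SenA a b"
| "contradictory (SenE a b) = SenI a b"
| "contradictory (SenI a b) = SenE a b"

text \<open>\<open>d_rule C P \<tau>\<close>: from the set \<open>P\<close> of premises infer \<open>\<tau>\<close>.\<close>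

inductive d_rule :: "'c set \<Rightarrow> 'c sentence set \<Rightarrow> 'c sentence \<Rightarrow> bool"
  for C :: "'c set" where
  A_Id: "a \<in> C \<Longrightarrow> d_rule C {} (SenA a a)"
| Apc: "\<lbrakk>a \<in> C; b \<in> C\<rbrakk> \<Longrightarrow> d_rule C {SenA a b} (SenI b a)"
| Ec: "\<lbrakk>a \<in> C; b \<in> C\<rbrakk> \<Longrightarrow> d_rule C {SenE a b} (SenE b a)"
| Barbara: "\<lbrakk>a \<in> C; b \<in> C; c \<in> C\<rbrakk> \<Longrightarrow> d_rule C {SenA a b, SenA b c} (SenA a c)"
| Celarent: "\<lbrakk>a \<in> C; b \<in> C; c \<in> C\<rbrakk> \<Longrightarrow> d_rule C {SenA a b, SenE b c} (SenE a c)"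

definition d_derivation :: "'c set \<Rightarrow> 'c sentence set \<Rightarrow> 'c sentence list \<Rightarrow> bool" where
  "d_derivation C \<Gamma> xs \<longleftrightarrow>
     xs \<noteq> [] \<and> set xs \<subseteq> BN C \<and>
     (\<forall>i<length xs. xs ! i \<in> \<Gamma> \<or> (\<exists>P. d_rule C P (xs ! i) \<and> P \<subseteq> set (take i xs)))"

definition d_derives :: "'c set \<Rightarrow> 'c sentence set \<Rightarrow> 'c sentence \<Rightarrow> bool" where
  "d_derives C \<Gamma> \<sigma> \<longleftrightarrow> (\<exists>xs. d_derivation C \<Gamma> xs \<and> last xs = \<sigma>)"

definition inconsistent :: "'c set \<Rightarrow> 'c sentence set \<Rightarrow> bool" where
  "inconsistent C \<Gamma> \<longleftrightarrow>
     (\<exists>\<sigma>\<in>BN C. d_derives C \<Gamma> \<sigma> \<and> d_derives C \<Gamma> (contradictory \<sigma>))"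

definition g_derives :: "'c set \<Rightarrow> 'c sentence set \<Rightarrow> 'c sentence \<Rightarrow> bool" where
  "g_derives C \<Gamma> \<sigma> \<longleftrightarrow> inconsistent C (\<Gamma> \<union> {contradictory \<sigma>})"

definition venn_model :: "'c set \<Rightarrow> 'u set set \<Rightarrow> ('c \<Rightarrow> 'u set) \<Rightarrow> bool" where
  "venn_model C B \<mu> \<longleftrightarrow> B \<noteq> {} \<and> (\<forall>X\<in>B. X \<noteq> {}) \<and> (\<forall>a\<in>C. \<mu> a \<in> B)"

primrec venn_true :: "('c \<Rightarrow> 'u set) \<Rightarrow> 'c sentence \<Rightarrow> bool" where
  "venn_true \<mu> (SenA a b) \<longleftrightarrow> \<mu> a \<subseteq> \<mu> b"
| "venn_true \<mu> (SenI a b) \<longleftrightarrow> \<mu> a \<inter> \<mu> b \<noteq> {}"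
| "venn_true \<mu> (SenE a b) \<longleftrightarrow> \<not> \<mu> a \<inter> \<mu> b \<noteq> {}"
| "venn_true \<mu> (SenO a b) \<longleftrightarrow> \<not> \<mu> a \<subseteq> \<mu> b"

text \<open>
  Semantic consequence quantifies over Venn models whose sets may have elements of any kind.
  A HOL formula cannot quantify over types, so consequence is indexed by the type \<open>'u\<close> of
  the elements. The lemma \<open>venn_entails_universal\<close> shows that the type \<open>'c set\<close> is already
  large enough: consequence over it implies consequence over every other type.
\<close>

definition venn_entails ::
  "'u itself \<Rightarrow> 'c set \<Rightarrow> 'c sentence set \<Rightarrow> 'c sentence \<Rightarrow> bool" where
  "venn_entails U C \<Gamma> \<sigma> \<longleftrightarrow>
     (\<forall>(B :: 'u set set) \<mu>. venn_model C B \<mu> \<longrightarrow> (\<forall>\<tau>\<in>\<Gamma>. venn_true \<mu> \<tau>) \<longrightarrow> venn_true \<mu> \<sigma>)"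

lemma venn_entails_universal:
  fixes C :: "'c set"
  assumes sub: "\<Gamma> \<union> {\<sigma>} \<subseteq> BN C" and ent: "venn_entails TYPE('c set) C \<Gamma> \<sigma>"
  shows "venn_entails TYPE('u) C \<Gamma> \<sigma>"
  unfolding venn_entails_def
proof (intro allI impI)
  fix B :: "'u set set" and \<mu>
  assume m: "venn_model C B \<mu>" and t: "\<forall>\<tau>\<in>\<Gamma>. venn_true \<mu> \<tau>"
  define \<nu> where "\<nu> a = (\<lambda>u. {c \<in> C. u \<in> \<mu> c}) ` \<mu> a" for a
  have mem: "{c \<in> C. u \<in> \<mu> c} \<in> \<nu> a \<longleftrightarrow> u \<in> \<mu> a" if "a \<in> C" for a u
    using that by (auto simp: \<nu>_def)
  have eq: "venn_true \<nu> \<tau> \<longleftrightarrow> venn_true \<mu> \<tau>" if "\<tau> \<in> BN C" for \<tau>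
  proof -
    have 1: "\<nu> a \<subseteq> \<nu> b \<longleftrightarrow> \<mu> a \<subseteq> \<mu> b" if "a \<in> C" "b \<in> C" for a b
    proof
      assume *: "\<nu> a \<subseteq> \<nu> b"
      show "\<mu> a \<subseteq> \<mu> b"
      proof
        fix u assume "u \<in> \<mu> a"
        then have "{c \<in> C. u \<in> \<mu> c} \<in> \<nu> b" using mem[OF that(1)] * by blast
        then show "u \<in> \<mu> b" using mem[OF that(2)] by blast
      qed
    next
      assume "\<mu> a \<subseteq> \<mu> b"
      then show "\<nu> a \<subseteq> \<nu> b" unfolding \<nu>_def by (rule image_mono)
    qed
    have 2: "\<nu> a \<inter> \<nu> b \<noteq> {} \<longleftrightarrow> \<mu> a \<inter> \<mu> b \<noteq> {}" if "a \<in> C" "b \<in> C" for a b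
    proof
      assume "\<nu> a \<inter> \<nu> b \<noteq> {}"
      then obtain X where X: "X \<in> \<nu> a" "X \<in> \<nu> b" by blast
      from X(1) obtain u where u: "X = {c \<in> C. u \<in> \<mu> c}" unfolding \<nu>_def by blast
      have "u \<in> \<mu> a \<inter> \<mu> b"
        using X mem[OF that(1), of u] mem[OF that(2), of u] unfolding u by blast
      then show "\<mu> a \<inter> \<mu> b \<noteq> {}" by blast
    next
      assume "\<mu> a \<inter> \<mu> b \<noteq> {}"
      then show "\<nu> a \<inter> \<nu> b \<noteq> {}" unfolding \<nu>_def by blast
    qed
    from that obtain a b where ab: "a \<in> C" "b \<in> C"
      and "\<tau> = SenA a b \<or> \<tau> = SenE a b \<or> \<tau> = SenI a b \<or> \<tau> = SenO a b"
      unfolding BN_def by blast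
    then show ?thesis
      by (elim disjE) (simp_all only: venn_true.simps 1[OF ab] 2[OF ab])
  qed
  have "venn_model C {X. X \<noteq> {}} \<nu>"
    using m by (auto simp: venn_model_def \<nu>_def)
  moreover have "\<forall>\<tau>\<in>\<Gamma>. venn_true \<nu> \<tau>" using t eq sub by auto
  ultimately have "venn_true \<nu> \<sigma>" using ent unfolding venn_entails_def by blast
  then show "venn_true \<mu> \<sigma>" using eq sub by auto
qed

end

theory Submission
  imports Defs
begin

text \<open>
  Soundness is an induction along derivations. For completeness, let \<open>\<Delta>\<close> be consistent. Call a
  constant \<open>c\<close> above \<open>a\<close> if \<open>Aac\<close> is derivable from \<open>\<Delta>\<close>, and let the points be the sets of
  constants above \<open>x\<close> or \<open>y\<close>, for all derivable \<open>Ixy\<close>. Interpreting \<open>c\<close> by the set of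
  points containing it gives a Venn model of \<open>\<Delta>\<close>: an \<open>Oab\<close> is witnessed by the constants above
  \<open>a\<close>, and a point violating an \<open>Eab\<close> would, by Celarent and Ec, make \<open>Exx\<close>, \<open>Eyy\<close> or \<open>Exy\<close>
  derivable.
\<close>

lemma BN_simps [simp]:
  "SenA a b \<in> BN C \<longleftrightarrow> a \<in> C \<and> b \<in> C"
  "SenE a b \<in> BN C \<longleftrightarrow> a \<in> C \<and> b \<in> C"
  "SenI a b \<in> BN C \<longleftrightarrow> a \<in> C \<and> b \<in> C"
  "SenO a b \<in> BN C \<longleftrightarrow> a \<in> C \<and> b \<in> C"
  by (auto simp: BN_def)

lemma contradictory_in_BN: "\<sigma> \<in> BN C \<Longrightarrow> contradictory \<sigma> \<in> BN C"
  by (cases \<sigma>) auto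

lemma venn_true_contradictory [simp]: "venn_true \<mu> (contradictory \<sigma>) \<longleftrightarrow> \<not> venn_true \<mu> \<sigma>"
  by (cases \<sigma>) auto

lemma d_rule_conclusion_in_BN: "d_rule C P \<tau> \<Longrightarrow> \<tau> \<in> BN C"
  by (induction rule: d_rule.induct) auto

lemma d_rule_finite_premises: "d_rule C P \<tau> \<Longrightarrow> finite P"
  by (induction rule: d_rule.induct) auto

text \<open>A step of \<open>ys\<close> keeps its justification after \<open>xs\<close> is put in
  front, since its earlier terms remain earlier. This allows derivations of several premises to be
  merged.\<close>

lemma d_derivation_append:
  assumes xs: "d_derivation C \<Gamma> xs" and ys: "d_derivation C \<Gamma> ys"
  shows "d_derivation C \<Gamma> (xs @ ys)"
proof -
  have "(xs @ ys) ! i \<in> \<Gamma> \<or> (\<exists>P. d_rule C P ((xs @ ys) ! i) \<and> P \<subseteq> set (take i (xs @ ys)))"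
    if i: "i < length (xs @ ys)" for i
  proof (cases "i < length xs")
    case True
    with xs show ?thesis by (auto simp: d_derivation_def nth_append)
  next
    case False
    with i have "i - length xs < length ys" by auto
    with ys have "ys ! (i - length xs) \<in> \<Gamma> \<or>
        (\<exists>P. d_rule C P (ys ! (i - length xs)) \<and> P \<subseteq> set (take (i - length xs) ys))"
      unfolding d_derivation_def by blast
    with False show ?thesis by (auto simp: nth_append)
  qed
  with xs ys show ?thesis by (auto simp: d_derivation_def)
qed

lemma d_derives_premise:
  assumes "\<sigma> \<in> \<Gamma>" "\<sigma> \<in> BN C"
  shows "d_derives C \<Gamma> \<sigma>"
  unfolding d_derives_def using assms by (intro exI[of _ "[\<sigma>]"]) (simp add: d_derivation_def)

lemma d_derives_rule:
  assumes rule: "d_rule C P \<tau>" and prems: "\<And>\<rho>. \<rho> \<in> P \<Longrightarrow> d_derives C \<Gamma> \<rho>"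
  shows "d_derives C \<Gamma> \<tau>"
proof -
  \<comment> \<open>The empty list is allowed here because A-Id has no premises while a derivation
    must be nonempty.\<close>
  have "\<exists>xs. (xs = [] \<or> d_derivation C \<Gamma> xs) \<and> P \<subseteq> set xs"
    using d_rule_finite_premises[OF rule] prems
  proof (induction P rule: finite_induct)
    case empty
    then show ?case by auto
  next
    case (insert \<rho> P)
    then obtain xs where xs: "xs = [] \<or> d_derivation C \<Gamma> xs" "P \<subseteq> set xs" by blast
    from insert.prems obtain ys where ys: "d_derivation C \<Gamma> ys" "last ys = \<rho>"
      unfolding d_derives_def by blast
    then have "\<rho> \<in> set ys" by (auto simp: d_derivation_def)
    with xs ys show ?case
      by (intro exI[of _ "xs @ ys"]) (auto intro: d_derivation_append)
  qed
  then obtain xs where xs: "xs = [] \<or> d_derivation C \<Gamma> xs" "P \<subseteq> set xs" by blast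
  have "d_derivation C \<Gamma> (xs @ [\<tau>])"
    using xs rule d_rule_conclusion_in_BN[OF rule]
    by (auto simp: d_derivation_def nth_append less_Suc_eq)
  then show ?thesis unfolding d_derives_def by (intro exI[of _ "xs @ [\<tau>]"]) simp
qed

text \<open>Supplies the side conditions on constants, so that the derived forms of the rules with
  premises carry none.\<close>

lemma d_derives_in_BN: "d_derives C \<Gamma> \<sigma> \<Longrightarrow> \<sigma> \<in> BN C"
  unfolding d_derives_def d_derivation_def using last_in_set by blast

lemma d_derives_A_Id: "a \<in> C \<Longrightarrow> d_derives C \<Gamma> (SenA a a)"
  by (rule d_derives_rule[OF A_Id]) auto

lemma d_derives_Apc: "d_derives C \<Gamma> (SenA a b) \<Longrightarrow> d_derives C \<Gamma> (SenI b a)"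
  by (rule d_derives_rule[OF Apc]) (auto dest: d_derives_in_BN)

lemma d_derives_Ec: "d_derives C \<Gamma> (SenE a b) \<Longrightarrow> d_derives C \<Gamma> (SenE b a)"
  by (rule d_derives_rule[OF Ec]) (auto dest: d_derives_in_BN)

lemma d_derives_Barbara:
  "d_derives C \<Gamma> (SenA a b) \<Longrightarrow> d_derives C \<Gamma> (SenA b c) \<Longrightarrow> d_derives C \<Gamma> (SenA a c)"
  by (rule d_derives_rule[OF Barbara[of a C b c]]) (auto dest: d_derives_in_BN)

lemma d_derives_Celarent:
  "d_derives C \<Gamma> (SenA a b) \<Longrightarrow> d_derives C \<Gamma> (SenE b c) \<Longrightarrow> d_derives C \<Gamma> (SenE a c)"
  by (rule d_derives_rule[OF Celarent[of a C b c]]) (auto dest: d_derives_in_BN)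

text \<open>Celarent lowers only the first term of an E-sentence; Ec swaps the terms so that it can
  be applied to the second as well: Exb, Ebx, Eyx, Exy.\<close>

lemma d_derives_E_below:
  assumes "d_derives C \<Gamma> (SenE a b)" "d_derives C \<Gamma> (SenA x a)" "d_derives C \<Gamma> (SenA y b)"
  shows "d_derives C \<Gamma> (SenE x y)"
  using assms by (meson d_derives_Celarent d_derives_Ec)

lemma d_rule_sound:
  assumes "d_rule C P \<tau>" "venn_model C B \<mu>" "\<forall>\<rho>\<in>P. venn_true \<mu> \<rho>"
  shows "venn_true \<mu> \<tau>"
  using assms
proof (induction rule: d_rule.induct)
  case (Apc a b)
  \<comment> \<open>Existential import: an element of \<open>\<mu> a\<close> is the common element
    that Iba asks for.\<close>
  then have "\<mu> a \<noteq> {}" by (auto simp: venn_model_def)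
  with Apc show ?case by auto
qed auto

lemma d_derives_sound:
  assumes "d_derives C \<Gamma> \<sigma>" and m: "venn_model C B \<mu>" and t: "\<forall>\<tau>\<in>\<Gamma>. venn_true \<mu> \<tau>"
  shows "venn_true \<mu> \<sigma>"
proof -
  obtain xs where xs: "d_derivation C \<Gamma> xs" "last xs = \<sigma>"
    using assms unfolding d_derives_def by blast
  have "venn_true \<mu> (xs ! i)" if "i < length xs" for i
    using that
  proof (induction i rule: less_induct)
    case (less i)
    from xs less.prems consider "xs ! i \<in> \<Gamma>"
      | P where "d_rule C P (xs ! i)" "P \<subseteq> set (take i xs)"
      unfolding d_derivation_def by blast
    then show ?case
    proof cases
      case 1
      with t show ?thesis by blast
    next
      case (2 P)
      \<comment> \<open>Each premise stands at a position before \<open>i\<close>, where the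
        induction hypothesis applies.\<close>
      have "venn_true \<mu> \<rho>" if "\<rho> \<in> P" for \<rho>
        using that 2 less by (fastforce simp: in_set_conv_nth)
      with 2 m show ?thesis by (blast intro: d_rule_sound)
    qed
  qed
  with xs show ?thesis by (auto simp: d_derivation_def last_conv_nth)
qed

lemma inconsistent_no_venn_model:
  assumes "inconsistent C \<Gamma>" "venn_model C B \<mu>"
  shows "\<exists>\<tau>\<in>\<Gamma>. \<not> venn_true \<mu> \<tau>"
  using assms d_derives_sound unfolding inconsistent_def by (metis venn_true_contradictory)

text \<open>A countermodel would be a Venn model of the inconsistent set
  \<open>\<Gamma> \<union> {contradictory \<sigma>}\<close>.\<close>

lemma g_derives_sound: "g_derives C \<Gamma> \<sigma> \<Longrightarrow> venn_entails TYPE('u) C \<Gamma> \<sigma>"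
  unfolding g_derives_def venn_entails_def by (auto dest: inconsistent_no_venn_model)

lemma consistent_has_venn_model:
  fixes C :: "'c set"
  assumes con: "\<not> inconsistent C \<Delta>" and sub: "\<Delta> \<subseteq> BN C"
  shows "\<exists>(B :: 'c set set set) \<mu>. venn_model C B \<mu> \<and> (\<forall>\<tau>\<in>\<Delta>. venn_true \<mu> \<tau>)"
proof -
  define above where "above x y = {c. d_derives C \<Delta> (SenA x c) \<or> d_derives C \<Delta> (SenA y c)}" for x y
  define \<mu> where "\<mu> c = {above x y |x y. d_derives C \<Delta> (SenI x y) \<and> c \<in> above x y}" for c
  have contr: False if "d_derives C \<Delta> \<tau>" "d_derives C \<Delta> (contradictory \<tau>)" for \<tau>
    using con that d_derives_in_BN unfolding inconsistent_def by blast
  have I_refl: "d_derives C \<Delta> (SenI a a)" if "a \<in> C" for a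
    using that by (blast intro: d_derives_Apc d_derives_A_Id)
  \<comment> \<open>By Barbara this is the least point containing \<open>a\<close>. It shows that
    \<open>\<mu> a\<close> is nonempty and later witnesses the O-sentences.\<close>
  have principal: "above a a \<in> \<mu> a" if "a \<in> C" for a
    using that I_refl[OF that] d_derives_A_Id[OF that] unfolding \<mu>_def above_def by blast
  have "venn_model C {X. X \<noteq> {}} \<mu>"
    unfolding venn_model_def using principal by blast
  moreover have "venn_true \<mu> \<tau>" if \<tau>: "\<tau> \<in> \<Delta>" for \<tau>
  proof -
    have der: "d_derives C \<Delta> \<tau>" using \<tau> sub by (blast intro: d_derives_premise)
    show ?thesis
    proof (cases \<tau>)
      case (SenA a b)
      with der have "\<mu> a \<subseteq> \<mu> b"
        unfolding \<mu>_def above_def by (blast intro: d_derives_Barbara)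
      with SenA show ?thesis by simp
    next
      case (SenE a b)
      have False if "S \<in> \<mu> a" "S \<in> \<mu> b" for S
      proof -
        from that obtain x y where I: "d_derives C \<Delta> (SenI x y)"
          and S: "a \<in> above x y" "b \<in> above x y"
          unfolding \<mu>_def by blast
        from d_derives_in_BN[OF I] have xy: "x \<in> C" "y \<in> C" by auto
        \<comment> \<open>The three cases: \<open>a\<close> and \<open>b\<close> are both above
          \<open>x\<close>, both above \<open>y\<close>, or one is above each; Ec fixes the order in
          the last case.\<close>
        have "d_derives C \<Delta> (SenE x x) \<or> d_derives C \<Delta> (SenE y y) \<or> d_derives C \<Delta> (SenE x y)"
          using S der unfolding SenE above_def by (blast intro: d_derives_E_below d_derives_Ec)
        \<comment> \<open>Exx and Eyy clash with Ixx and Iyy, which come from A-Id and Apc; Exy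
          clashes with the Ixy that made the set a point.\<close>
        then show False
          using contr[of "SenE x x"] contr[of "SenE y y"] contr[of "SenE x y"] I I_refl xy
          by auto
      qed
      with SenE show ?thesis by auto
    next
      case (SenI a b)
      from d_derives_in_BN[OF der] SenI have "a \<in> C" "b \<in> C" by auto
      with der SenI have "above a b \<in> \<mu> a \<inter> \<mu> b"
        unfolding \<mu>_def by (auto simp: above_def intro: d_derives_A_Id)
      with SenI show ?thesis by auto
    next
      case (SenO a b)
      from d_derives_in_BN[OF der] SenO have "a \<in> C" by auto
      have "\<not> d_derives C \<Delta> (SenA a b)" using contr[of "SenA a b"] der SenO by auto
      \<comment> \<open>This point contains \<open>b\<close> only if Aab is derivable.\<close>
      then have "above a a \<notin> \<mu> b" by (auto simp: \<mu>_def above_def)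
      with principal[OF \<open>a \<in> C\<close>] SenO show ?thesis by auto
    qed
  qed
  ultimately show ?thesis by blast
qed

text \<open>The model of a consistent set has sets of constants as points, so consequence over
  element type \<open>'c set\<close> already excludes it.\<close>

lemma g_derives_complete:
  fixes C :: "'c set"
  assumes sub: "\<Gamma> \<union> {\<sigma>} \<subseteq> BN C" and ent: "venn_entails TYPE('c set) C \<Gamma> \<sigma>"
  shows "g_derives C \<Gamma> \<sigma>"
proof (rule ccontr)
  assume "\<not> g_derives C \<Gamma> \<sigma>"
  then obtain B :: "'c set set set" and \<mu>
    where "venn_model C B \<mu>" "\<forall>\<tau>\<in>\<Gamma> \<union> {contradictory \<sigma>}. venn_true \<mu> \<tau>"
    using consistent_has_venn_model[of C "\<Gamma> \<union> {contradictory \<sigma>}"] sub contradictory_in_BN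
    unfolding g_derives_def by blast
  with ent show False unfolding venn_entails_def by auto
qed

theorem theorem5p2:
  fixes C :: "'c set" and \<Gamma> :: "'c sentence set" and \<sigma> :: "'c sentence"
  assumes "\<exists>a\<in>C. \<exists>b\<in>C. \<exists>c\<in>C. a \<noteq> b \<and> a \<noteq> c \<and> b \<noteq> c"
    and "\<Gamma> \<union> {\<sigma>} \<subseteq> BN C"
  shows "(g_derives C \<Gamma> \<sigma> \<longleftrightarrow> venn_entails TYPE('c set) C \<Gamma> \<sigma>) \<and>
         (g_derives C \<Gamma> \<sigma> \<longrightarrow> venn_entails TYPE('u) C \<Gamma> \<sigma>)"
  by (intro conjI iffI impI) (simp_all only: g_derives_sound g_derives_complete[OF assms(2)])

end
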